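(* Let $T=(C_2\wr\mathfrak{S}_{24})\times(C_3\wr\mathfrak{S}_8)\times\mathfrak{S}_{24}$. Let $L\subset T$ be the subgroup of elements $((0,\sigma),(\theta,\tau),\phi)$ with $\sigma\in\mathfrak{S}_{24}$, $(\theta,\tau)\in C_3\wr\mathfrak{S}_8$, $\phi\in\mathfrak{S}_{24}$ such that $\sum_{i=1}^8\theta_i=0$ in $C_3$ and $\varepsilon(\tau)=\varepsilon(\phi)$. Let $I\subset T$ be the subgroup of elements $((\rho,\sigma),(0,\mathrm{Id}),\phi)$ such that: (i) $\sigma(\{2k-1,2k\})=\{2k-1,2k\}$ for all $1\le k\le 12$; (ii) $\phi(\{4k-3,4k-2,4k-1,4k\})=\{4k-3,4k-2,4k-1,4k\}$ for all $1\le k\le 6$; (iii) for all $1\le k\le 12$, if $\sigma|_{\{2k-1,2k\}}=\mathrm{Id}$ then $\rho_{2k-1}=\rho_{2k}=0$, and if $\sigma|_{\{2k-1,2k\}}\ne\mathrm{Id}$ then $\rho_{2k-1}=\rho_{2k}=1$. Then the set of double cosets satisfies $\#(I\backslash T/L)=3^{13}$.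
   Context: $C_n=\mathbf{Z}/n\mathbf{Z}$ (additive), $\mathfrak{S}_n$ is the symmetric group on $\{1,\dots,n\}$, and $\varepsilon$ is the signature. The wreath product $C_m\wr\mathfrak{S}_n$ is the set of pairs $(\rho,\sigma)$ with $\rho=(\rho_1,\dots,\rho_n)\in C_m^n$, $\sigma\in\mathfrak{S}_n$, with product $(\rho,\sigma)(\theta,\tau)=(\rho+\sigma\cdot\theta,\sigma\tau)$, where $(\sigma\cdot\theta)_i=\theta_{\sigma^{-1}(i)}$. $I\backslash T/L$ is the set of double cosets $ItL$, $t\in T$. *)

theory Defs
  imports "HOL-Algebra.Algebra"
begin

abbreviation tuple_group :: "nat \<Rightarrow> nat \<Rightarrow> (nat \<Rightarrow> int) monoid"
  where "tuple_group m n \<equiv> product_group {1..n} (\<lambda>_. integer_mod_group m)"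

definition permute_tuple :: "nat \<Rightarrow> (nat \<Rightarrow> nat) \<Rightarrow> (nat \<Rightarrow> int) \<Rightarrow> (nat \<Rightarrow> int)"
  where "permute_tuple n \<sigma> \<theta> = (\<lambda>i\<in>{1..n}. \<theta> (inv' \<sigma> i))"

definition wreath :: "nat \<Rightarrow> nat \<Rightarrow> ((nat \<Rightarrow> int) \<times> (nat \<Rightarrow> nat)) monoid"
  where "wreath m n =
    \<lparr> carrier = carrier (tuple_group m n) \<times> carrier (sym_group n),
      monoid.mult = (\<lambda>(\<rho>, \<sigma>) (\<theta>, \<tau>).
        (\<rho> \<otimes>\<^bsub>tuple_group m n\<^esub> permute_tuple n \<sigma> \<theta>, \<sigma> \<otimes>\<^bsub>sym_group n\<^esub> \<tau>)),
      one = (\<one>\<^bsub>tuple_group m n\<^esub>, \<one>\<^bsub>sym_group n\<^esub>) \<rparr>"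

lemma permute_tuple_closed:
  assumes "\<sigma> permutes {1..n}" "\<theta> \<in> carrier (tuple_group m n)"
  shows "permute_tuple n \<sigma> \<theta> \<in> carrier (tuple_group m n)"
proof -
  have "inv' \<sigma> i \<in> {1..n} \<longleftrightarrow> i \<in> {1..n}" for i
    using permutes_in_image[OF permutes_inv[OF assms(1)]] .
  then show ?thesis
    using assms(2) unfolding permute_tuple_def carrier_product_group
    by (intro restrict_PiE_iff[THEN iffD2] ballI) blast
qed

lemma permute_tuple_comp:
  assumes "\<sigma> permutes {1..n}" "\<tau> permutes {1..n}"
  shows "permute_tuple n (\<sigma> \<circ> \<tau>) \<theta> = permute_tuple n \<sigma> (permute_tuple n \<tau> \<theta>)"
proof
  fix i
  have "inv' \<sigma> i \<in> {1..n} \<longleftrightarrow> i \<in> {1..n}"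
    using permutes_in_image[OF permutes_inv[OF assms(1)]] .
  moreover have "inv' (\<sigma> \<circ> \<tau>) = inv' \<tau> \<circ> inv' \<sigma>"
    using assms by (simp add: permutes_bij o_inv_distrib)
  ultimately show "permute_tuple n (\<sigma> \<circ> \<tau>) \<theta> i = permute_tuple n \<sigma> (permute_tuple n \<tau> \<theta>) i"
    by (simp add: permute_tuple_def)
qed

lemma permute_tuple_mult:
  assumes "\<sigma> permutes {1..n}"
  shows "permute_tuple n \<sigma> (\<theta> \<otimes>\<^bsub>tuple_group m n\<^esub> \<eta>) =
    permute_tuple n \<sigma> \<theta> \<otimes>\<^bsub>tuple_group m n\<^esub> permute_tuple n \<sigma> \<eta>"
proof
  fix i
  have "inv' \<sigma> i \<in> {1..n} \<longleftrightarrow> i \<in> {1..n}"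
    using permutes_in_image[OF permutes_inv[OF assms]] .
  then show "permute_tuple n \<sigma> (\<theta> \<otimes>\<^bsub>tuple_group m n\<^esub> \<eta>) i =
    (permute_tuple n \<sigma> \<theta> \<otimes>\<^bsub>tuple_group m n\<^esub> permute_tuple n \<sigma> \<eta>) i"
    by (simp add: permute_tuple_def)
qed

lemma permute_tuple_id:
  "\<theta> \<in> carrier (tuple_group m n) \<Longrightarrow> permute_tuple n id \<theta> = \<theta>"
  unfolding permute_tuple_def carrier_product_group by (auto simp: PiE_restrict)

lemma permute_tuple_one:
  assumes "\<sigma> permutes {1..n}"
  shows "permute_tuple n \<sigma> \<one>\<^bsub>tuple_group m n\<^esub> = \<one>\<^bsub>tuple_group m n\<^esub>"
proof
  fix i
  have "inv' \<sigma> i \<in> {1..n} \<longleftrightarrow> i \<in> {1..n}"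
    using permutes_in_image[OF permutes_inv[OF assms]] .
  then show "permute_tuple n \<sigma> \<one>\<^bsub>tuple_group m n\<^esub> i = \<one>\<^bsub>tuple_group m n\<^esub> i"
    by (simp add: permute_tuple_def)
qed

lemma carrier_wreath: "carrier (wreath m n) = carrier (tuple_group m n) \<times> carrier (sym_group n)"
  and mult_wreath: "(\<rho>, \<sigma>) \<otimes>\<^bsub>wreath m n\<^esub> (\<theta>, \<tau>) =
    (\<rho> \<otimes>\<^bsub>tuple_group m n\<^esub> permute_tuple n \<sigma> \<theta>, \<sigma> \<circ> \<tau>)"
  and one_wreath: "\<one>\<^bsub>wreath m n\<^esub> = (\<one>\<^bsub>tuple_group m n\<^esub>, id)"
  by (simp_all add: wreath_def sym_group_mult sym_group_one del: carrier_product_group)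

lemma group_tuple_group: "group (tuple_group m n)"
  by simp

lemma group_wreath: "group (wreath m n)"
proof (rule groupI)
  interpret A: group "tuple_group m n" by (rule group_tuple_group)
  note [simp del] = One_nat_def carrier_product_group mult_product_group one_product_group inv_product_group
  note [simp] = carrier_wreath mult_wreath one_wreath sym_group_carrier
    permute_tuple_closed permute_tuple_mult permute_tuple_comp permute_tuple_id permute_tuple_one
    permutes_compose permutes_id
  show "x \<otimes>\<^bsub>wreath m n\<^esub> y \<in> carrier (wreath m n)"
    if "x \<in> carrier (wreath m n)" "y \<in> carrier (wreath m n)" for x y
    using that by (cases x; cases y) auto
  show "\<one>\<^bsub>wreath m n\<^esub> \<in> carrier (wreath m n)"
    by simp
  show "x \<otimes>\<^bsub>wreath m n\<^esub> y \<otimes>\<^bsub>wreath m n\<^esub> z = x \<otimes>\<^bsub>wreath m n\<^esub> (y \<otimes>\<^bsub>wreath m n\<^esub> z)"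
    if "x \<in> carrier (wreath m n)" "y \<in> carrier (wreath m n)" "z \<in> carrier (wreath m n)" for x y z
    using that by (cases x; cases y; cases z) (auto simp: A.m_assoc o_assoc)
  show "\<one>\<^bsub>wreath m n\<^esub> \<otimes>\<^bsub>wreath m n\<^esub> x = x" if "x \<in> carrier (wreath m n)" for x
    using that by (cases x) auto
  show "\<exists>y\<in>carrier (wreath m n). y \<otimes>\<^bsub>wreath m n\<^esub> x = \<one>\<^bsub>wreath m n\<^esub>"
    if "x \<in> carrier (wreath m n)" for x
  proof -
    obtain \<rho> \<sigma> where x: "x = (\<rho>, \<sigma>)" by (cases x)
    have \<rho>: "\<rho> \<in> carrier (tuple_group m n)" and \<sigma>: "\<sigma> permutes {1..n}"
      using that x by auto
    let ?a = "permute_tuple n (inv' \<sigma>) \<rho>"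
    have a: "?a \<in> carrier (tuple_group m n)"
      using \<rho> \<sigma> by (intro permute_tuple_closed permutes_inv)
    show ?thesis
      using a \<sigma>
      by (intro bexI[of _ "(inv\<^bsub>tuple_group m n\<^esub> ?a, inv' \<sigma>)"])
        (auto simp: x permutes_inv permutes_inv_o)
  qed
qed

definition double_cosets :: "('a, 'b) monoid_scheme \<Rightarrow> 'a set \<Rightarrow> 'a set \<Rightarrow> 'a set set"
  where "double_cosets G H K = {(H #>\<^bsub>G\<^esub> t) <#>\<^bsub>G\<^esub> K | t. t \<in> carrier G}"

type_synonym puzzle =
  "((nat \<Rightarrow> int) \<times> (nat \<Rightarrow> nat)) \<times> ((nat \<Rightarrow> int) \<times> (nat \<Rightarrow> nat)) \<times> (nat \<Rightarrow> nat)"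

definition T_group :: "puzzle monoid"
  where "T_group = wreath 2 24 \<times>\<times> wreath 3 8 \<times>\<times> sym_group 24"

(* integer_mod_group is written multiplicatively: its finprod is the sum in C_3. *)
definition L_subgroup :: "puzzle set"
  where "L_subgroup =
    {((\<one>\<^bsub>tuple_group 2 24\<^esub>, \<sigma>), (\<theta>, \<tau>), \<phi>) | \<sigma> \<theta> \<tau> \<phi>.
      \<sigma> \<in> carrier (sym_group 24) \<and>
      (\<theta>, \<tau>) \<in> carrier (wreath 3 8) \<and>
      \<phi> \<in> carrier (sym_group 24) \<and>
      (\<Otimes>\<^bsub>integer_mod_group 3\<^esub>i\<in>{1..8}. \<theta> i) = \<one>\<^bsub>integer_mod_group 3\<^esub> \<and>
      sign \<tau> = sign \<phi>}"

definition I_subgroup :: "puzzle set"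
  where "I_subgroup =
    {((\<rho>, \<sigma>), (\<one>\<^bsub>tuple_group 3 8\<^esub>, id), \<phi>) | \<rho> \<sigma> \<phi>.
      (\<rho>, \<sigma>) \<in> carrier (wreath 2 24) \<and>
      \<phi> \<in> carrier (sym_group 24) \<and>
      (\<forall>k\<in>{1..12}. \<sigma> ` {2*k-1, 2*k} = {2*k-1, 2*k}) \<and>
      (\<forall>k\<in>{1..6}. \<phi> ` {4*k-3, 4*k-2, 4*k-1, 4*k} = {4*k-3, 4*k-2, 4*k-1, 4*k}) \<and>
      (\<forall>k\<in>{1..12}.
        ((\<forall>i\<in>{2*k-1, 2*k}. \<sigma> i = i) \<longrightarrow> \<rho> (2*k-1) = 0 \<and> \<rho> (2*k) = 0) \<and>
        (\<not> (\<forall>i\<in>{2*k-1, 2*k}. \<sigma> i = i) \<longrightarrow> \<rho> (2*k-1) = 1 \<and> \<rho> (2*k) = 1))}"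

lemma group_T_group: "group T_group"
  unfolding T_group_def by (intro DirProd_group group_wreath sym_group_is_group)

lemma finite_T_group: "finite (carrier T_group)"
  by (auto simp: T_group_def carrier_wreath carrier_integer_mod_group sym_group_def
      intro!: finite_PiE finite_permutations)

lemma (in group) finite_subgroupI:
  assumes "finite (carrier G)" "H \<subseteq> carrier G" "\<one> \<in> H"
    and closed: "\<And>x y. x \<in> H \<Longrightarrow> y \<in> H \<Longrightarrow> x \<otimes> y \<in> H"
  shows "subgroup H G"
proof (rule subgroupI)
  show "inv a \<in> H" if "a \<in> H" for a
  proof -
    have a: "a \<in> carrier G" using that assms(2) by blast
    have pow: "a [^] k \<in> H" for k :: nat
      using that assms(3) closed by (induction k) auto
    have "order G = Suc (order G - 1)"
      using order_gt_0_iff_finite assms(1) by simp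
    then have "a [^] (order G - 1) \<otimes> a = \<one>"
      using pow_order_eq_1[OF a] by (metis nat_pow_Suc)
    then have "inv a = a [^] (order G - 1)"
      using a by (simp add: inv_equality)
    then show ?thesis using pow by simp
  qed
qed (use assms in auto)

lemma finprod_permute_tuple:
  assumes "\<sigma> permutes {1..n}" "\<theta> \<in> carrier (tuple_group m n)"
  shows "(\<Otimes>\<^bsub>integer_mod_group m\<^esub>i\<in>{1..n}. permute_tuple n \<sigma> \<theta> i) =
    (\<Otimes>\<^bsub>integer_mod_group m\<^esub>i\<in>{1..n}. \<theta> i)"
proof -
  interpret C: comm_group "integer_mod_group m" by simp
  have p: "inv' \<sigma> permutes {1..n}" using assms(1) by (rule permutes_inv)
  have \<theta>: "\<theta> \<in> {1..n} \<rightarrow> carrier (integer_mod_group m)" using assms(2) by auto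
  have "(\<Otimes>\<^bsub>integer_mod_group m\<^esub>i\<in>{1..n}. permute_tuple n \<sigma> \<theta> i) =
    (\<Otimes>\<^bsub>integer_mod_group m\<^esub>i\<in>{1..n}. \<theta> (inv' \<sigma> i))"
    using \<theta> permutes_in_image[OF p]
    by (intro C.finprod_cong') (auto simp: permute_tuple_def)
  also have "\<dots> = (\<Otimes>\<^bsub>integer_mod_group m\<^esub>i\<in>inv' \<sigma> ` {1..n}. \<theta> i)"
    using \<theta> permutes_image[OF p] permutes_inj_on[OF p]
    by (intro C.finprod_reindex[symmetric]) auto
  finally show ?thesis using permutes_image[OF p] by simp
qed

lemma finprod_tuple_mult:
  assumes "\<theta> \<in> carrier (tuple_group m n)" "\<eta> \<in> carrier (tuple_group m n)"
  shows "(\<Otimes>\<^bsub>integer_mod_group m\<^esub>i\<in>{1..n}. (\<theta> \<otimes>\<^bsub>tuple_group m n\<^esub> \<eta>) i) =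
    (\<Otimes>\<^bsub>integer_mod_group m\<^esub>i\<in>{1..n}. \<theta> i) \<otimes>\<^bsub>integer_mod_group m\<^esub>
    (\<Otimes>\<^bsub>integer_mod_group m\<^esub>i\<in>{1..n}. \<eta> i)"
proof -
  interpret C: comm_group "integer_mod_group m" by simp
  have *: "\<theta> \<in> {1..n} \<rightarrow> carrier (integer_mod_group m)" "\<eta> \<in> {1..n} \<rightarrow> carrier (integer_mod_group m)"
    using assms by auto
  have "(\<Otimes>\<^bsub>integer_mod_group m\<^esub>i\<in>{1..n}. (\<theta> \<otimes>\<^bsub>tuple_group m n\<^esub> \<eta>) i) =
    (\<Otimes>\<^bsub>integer_mod_group m\<^esub>i\<in>{1..n}. \<theta> i \<otimes>\<^bsub>integer_mod_group m\<^esub> \<eta> i)"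
    using * C.m_closed
    by (intro C.finprod_cong') (auto simp del: mult_integer_mod_group simp: Pi_iff)
  then show ?thesis using C.finprod_multf[OF *] by simp
qed

lemma subgroup_L: "subgroup L_subgroup T_group"
proof -
  interpret T: group T_group by (rule group_T_group)
  interpret A: group "tuple_group 2 24" by (rule group_tuple_group)
  interpret B: group "tuple_group 3 8" by (rule group_tuple_group)
  interpret C: comm_group "integer_mod_group 3" by simp
  note [simp del] = One_nat_def carrier_product_group mult_product_group one_product_group inv_product_group
    mult_integer_mod_group one_integer_mod_group
  note [simp] = carrier_wreath mult_wreath one_wreath sym_group_carrier
    permute_tuple_closed permute_tuple_one permutes_compose permutes_id
  show ?thesis
  proof (rule T.finite_subgroupI[OF finite_T_group])
    show "L_subgroup \<subseteq> carrier T_group"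
      by (auto simp: L_subgroup_def T_group_def)
    have "(\<Otimes>\<^bsub>integer_mod_group 3\<^esub>i\<in>{1..8::nat}. \<one>\<^bsub>tuple_group 3 8\<^esub> i) = \<one>\<^bsub>integer_mod_group 3\<^esub>"
      by (rule C.finprod_one_eqI) (simp add: one_product_group)
    then show "\<one>\<^bsub>T_group\<^esub> \<in> L_subgroup"
      by (auto simp: L_subgroup_def T_group_def sym_group_one)
    show "x \<otimes>\<^bsub>T_group\<^esub> y \<in> L_subgroup" if "x \<in> L_subgroup" "y \<in> L_subgroup" for x y
      using that
      by (auto simp: L_subgroup_def T_group_def sym_group_mult finprod_tuple_mult
          finprod_permute_tuple sign_compose permutes_imp_permutation[OF finite_atLeastAtMost])
  qed
qed

lemma I_subgroup_iff:
  "((\<rho>, \<sigma>), (\<one>\<^bsub>tuple_group 3 8\<^esub>, id), \<phi>) \<in> I_subgroup \<longleftrightarrow>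
      (\<rho>, \<sigma>) \<in> carrier (wreath 2 24) \<and>
      \<phi> \<in> carrier (sym_group 24) \<and>
      (\<forall>k\<in>{1..12}. \<sigma> ` {2*k-1, 2*k} = {2*k-1, 2*k}) \<and>
      (\<forall>k\<in>{1..6}. \<phi> ` {4*k-3, 4*k-2, 4*k-1, 4*k} = {4*k-3, 4*k-2, 4*k-1, 4*k}) \<and>
      (\<forall>k\<in>{1..12}.
        ((\<forall>i\<in>{2*k-1, 2*k}. \<sigma> i = i) \<longrightarrow> \<rho> (2*k-1) = 0 \<and> \<rho> (2*k) = 0) \<and>
        (\<not> (\<forall>i\<in>{2*k-1, 2*k}. \<sigma> i = i) \<longrightarrow> \<rho> (2*k-1) = 1 \<and> \<rho> (2*k) = 1))"
proof -
  have "((\<rho>, \<sigma>), c, \<phi>) \<in> {((\<rho>, \<sigma>), c, \<phi>) | \<rho> \<sigma> \<phi>. P \<rho> \<sigma> \<phi>} \<longleftrightarrow> P \<rho> \<sigma> \<phi>"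
    for c :: "(nat \<Rightarrow> int) \<times> (nat \<Rightarrow> nat)" and P
    by blast
  then show ?thesis unfolding I_subgroup_def .
qed

lemma subgroup_I: "subgroup I_subgroup T_group"
proof -
  interpret T: group T_group by (rule group_T_group)
  interpret A: group "tuple_group 2 24" by (rule group_tuple_group)
  interpret B: group "tuple_group 3 8" by (rule group_tuple_group)
  note [simp del] = One_nat_def carrier_product_group mult_product_group one_product_group inv_product_group
  note [simp] = carrier_wreath mult_wreath one_wreath sym_group_carrier
    permute_tuple_closed permute_tuple_one permutes_compose permutes_id
  show ?thesis
  proof (rule T.finite_subgroupI[OF finite_T_group])
    show "I_subgroup \<subseteq> carrier T_group"
      by (auto simp: I_subgroup_def T_group_def)
    have one: "\<one>\<^bsub>tuple_group 2 24\<^esub> (2*k-1) = 0" "\<one>\<^bsub>tuple_group 2 24\<^esub> (2*k) = 0"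
      if "1 \<le> k" "k \<le> 12" for k
    proof -
      have "2*k-1 \<in> {1..24}" "2*k \<in> {1..24}" using that by auto
      then show "\<one>\<^bsub>tuple_group 2 24\<^esub> (2*k-1) = 0" "\<one>\<^bsub>tuple_group 2 24\<^esub> (2*k) = 0"
        unfolding one_product_group one_integer_mod_group by (simp_all only: restrict_apply if_True)
    qed
    show "\<one>\<^bsub>T_group\<^esub> \<in> I_subgroup"
      by (auto simp: I_subgroup_def T_group_def sym_group_one one)
    fix x y assume "x \<in> I_subgroup" "y \<in> I_subgroup"
    then obtain \<rho> \<sigma> \<phi> \<rho>' \<sigma>' \<phi>' where
      x: "x = ((\<rho>, \<sigma>), (\<one>\<^bsub>tuple_group 3 8\<^esub>, id), \<phi>)" and
      y: "y = ((\<rho>', \<sigma>'), (\<one>\<^bsub>tuple_group 3 8\<^esub>, id), \<phi>')" and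
      mem: "((\<rho>, \<sigma>), (\<one>\<^bsub>tuple_group 3 8\<^esub>, id), \<phi>) \<in> I_subgroup"
        "((\<rho>', \<sigma>'), (\<one>\<^bsub>tuple_group 3 8\<^esub>, id), \<phi>') \<in> I_subgroup"
      unfolding I_subgroup_def by blast
    have c: "\<rho> \<in> carrier (tuple_group 2 24)" "\<rho>' \<in> carrier (tuple_group 2 24)"
      "\<sigma> permutes {1..24}" "\<sigma>' permutes {1..24}" "\<phi> permutes {1..24}" "\<phi>' permutes {1..24}"
      using mem[unfolded I_subgroup_iff] by simp_all
    let ?\<rho> = "\<rho> \<otimes>\<^bsub>tuple_group 2 24\<^esub> permute_tuple 24 \<sigma> \<rho>'"
    have im: "(\<sigma> \<circ> \<sigma>') ` {2*k-1, 2*k} = {2*k-1, 2*k}" if "k \<in> {1..12}" for k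
    proof -
      have "\<sigma> ` {2*k-1, 2*k} = {2*k-1, 2*k}" "\<sigma>' ` {2*k-1, 2*k} = {2*k-1, 2*k}"
        using mem[unfolded I_subgroup_iff] that by simp_all
      then show ?thesis by (metis image_comp)
    qed
    have im': "(\<phi> \<circ> \<phi>') ` {4*k-3, 4*k-2, 4*k-1, 4*k} = {4*k-3, 4*k-2, 4*k-1, 4*k}"
      if "k \<in> {1..6}" for k
    proof -
      have "\<phi> ` {4*k-3, 4*k-2, 4*k-1, 4*k} = {4*k-3, 4*k-2, 4*k-1, 4*k}"
        "\<phi>' ` {4*k-3, 4*k-2, 4*k-1, 4*k} = {4*k-3, 4*k-2, 4*k-1, 4*k}"
        using mem[unfolded I_subgroup_iff] that by simp_all
      then show ?thesis by (metis image_comp)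
    qed
    have flip: "((\<forall>i\<in>{2*k-1, 2*k}. (\<sigma> \<circ> \<sigma>') i = i) \<longrightarrow> ?\<rho> (2*k-1) = 0 \<and> ?\<rho> (2*k) = 0) \<and>
        (\<not> (\<forall>i\<in>{2*k-1, 2*k}. (\<sigma> \<circ> \<sigma>') i = i) \<longrightarrow> ?\<rho> (2*k-1) = 1 \<and> ?\<rho> (2*k) = 1)"
      if k: "k \<in> {1..12}" for k
    proof -
      note im1 = mem[unfolded I_subgroup_iff, THEN conjunct2, THEN conjunct2, THEN conjunct1]
      note fl = mem[unfolded I_subgroup_iff, THEN conjunct2, THEN conjunct2, THEN conjunct2, THEN conjunct2]
      define a b where "a = 2*k-1" and "b = 2*k"
      have ab: "a \<in> {1..24}" "b \<in> {1..24}" "a \<noteq> b" using k by (auto simp: a_def b_def)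
      have s: "\<sigma> ` {a, b} = {a, b}" "\<sigma>' ` {a, b} = {a, b}"
        using bspec[OF im1(1) k] bspec[OF im1(2) k]
        unfolding a_def[symmetric] unfolding b_def[symmetric] .
      have e: "\<rho> i = (if \<sigma> a = a \<and> \<sigma> b = b then 0 else 1)" if "i \<in> {a, b}" for i
        using bspec[OF fl(1) k] that unfolding a_def[symmetric] unfolding b_def[symmetric] by auto
      have e': "\<rho>' i = (if \<sigma>' a = a \<and> \<sigma>' b = b then 0 else 1)" if "i \<in> {a, b}" for i
        using bspec[OF fl(2) k] that unfolding a_def[symmetric] unfolding b_def[symmetric] by auto
      have cs: "\<sigma> a = a \<and> \<sigma> b = b \<or> \<sigma> a = b \<and> \<sigma> b = a"
        "\<sigma>' a = a \<and> \<sigma>' b = b \<or> \<sigma>' a = b \<and> \<sigma>' b = a"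
        using s by (simp_all only: image_insert image_empty doubleton_eq_iff)
      have "inv' \<sigma> i \<in> {a, b}" if "i \<in> {a, b}" for i
        using that s(1) permutes_inverses(2)[OF c(3)] by (metis imageE)
      then have inv: "\<rho>' (inv' \<sigma> i) = \<rho>' a" if "i \<in> {a, b}" for i
        using that e'[of a] e'[of "inv' \<sigma> i"] by simp
      have "?\<rho> i = (\<rho> i + \<rho>' (inv' \<sigma> i)) mod 2" if "i \<in> {1..24}" for i
        using that by (simp add: mult_product_group permute_tuple_def)
      then have sum: "?\<rho> i = (\<rho> i + \<rho>' a) mod 2" if "i \<in> {a, b}" for i
        using that ab inv[OF that] by (metis insertE singletonD)
      have "?\<rho> i = (if (\<sigma> \<circ> \<sigma>') a = a \<and> (\<sigma> \<circ> \<sigma>') b = b then 0 else 1)" if "i \<in> {a, b}" for i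
        unfolding sum[OF that] e[OF that] e'[OF insertI1] using cs ab(3) by (elim disjE conjE) simp_all
      then show ?thesis unfolding a_def[symmetric] unfolding b_def[symmetric] by auto
    qed
    have xy: "x \<otimes>\<^bsub>T_group\<^esub> y =
      ((?\<rho>, \<sigma> \<circ> \<sigma>'), (\<one>\<^bsub>tuple_group 3 8\<^esub>, id), \<phi> \<circ> \<phi>')"
      by (simp add: x y T_group_def sym_group_mult)
    have car: "(?\<rho>, \<sigma> \<circ> \<sigma>') \<in> carrier (wreath 2 24)" "\<phi> \<circ> \<phi>' \<in> carrier (sym_group 24)"
      using c by auto
    show "x \<otimes>\<^bsub>T_group\<^esub> y \<in> I_subgroup"
      unfolding xy I_subgroup_iff by (intro conjI[OF car(1)] conjI[OF car(2)] conjI[OF _ conjI] ballI)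
        (fact im im' flip)+
  qed
qed

end

theory Submission
  imports Defs
begin

text \<open>
  A coset \<open>t L\<close> forgets everything about \<open>((\<rho>, \<sigma>), (\<theta>, \<tau>), \<phi>)\<close> except \<open>\<rho>\<close>, the sum of
  \<open>\<theta>\<close> and the sign \<open>sign \<tau> * sign \<phi>\<close> (\<open>mem_L_coset_iff\<close>). The group \<open>I\<close> acts on these triples.
  It does not touch the sum. It acts transitively on the sign, since \<open>\<phi>\<close> may be multiplied by a
  transposition inside one block of four, independently of everything else. On \<open>\<rho>\<close> it acts through
  twelve commuting involutions, the \<open>k\<close>-th of which replaces the pair
  \<open>(x, y) = (\<rho> (2*k-1), \<rho> (2*k))\<close> by \<open>(1 - y, 1 - x)\<close>. This exchanges \<open>(0, 0)\<close> with \<open>(1, 1)\<close> and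
  fixes \<open>(0, 1)\<close> and \<open>(1, 0)\<close>; its three orbits are separated by the difference \<open>x - y\<close>, taken in
  the integers with representatives \<open>0\<close> and \<open>1\<close>.

  Hence the twelve differences together with the sum of \<open>\<theta>\<close> form a complete invariant of double
  cosets (\<open>puzzle_invariant_eq_iff\<close>), with values in a set of \<open>3^12 * 3\<close> elements, all of which occur.
\<close>

section \<open>Counting double cosets by a complete invariant\<close>

lemma double_coset_altdef:
  "(H #>\<^bsub>G\<^esub> t) <#>\<^bsub>G\<^esub> K = {h \<otimes>\<^bsub>G\<^esub> t \<otimes>\<^bsub>G\<^esub> k | h k. h \<in> H \<and> k \<in> K}"
  by (auto simp: r_coset_def set_mult_def)

lemma (in group) card_double_cosets_eq_card_invariants:
  assumes "H \<subseteq> carrier G" "K \<subseteq> carrier G"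
    and complete: "\<And>s t. s \<in> carrier G \<Longrightarrow> t \<in> carrier G \<Longrightarrow>
      f s = f t \<longleftrightarrow> (\<exists>h\<in>H. \<exists>k\<in>K. s = h \<otimes> t \<otimes> k)"
  shows "card (double_cosets G H K) = card (f ` carrier G)"
proof -
  let ?fibre = "\<lambda>w. {s \<in> carrier G. f s = w}"
  have fibre: "(H #> t) <#> K = ?fibre (f t)" if t: "t \<in> carrier G" for t
  proof (intro equalityI subsetI)
    fix s assume "s \<in> (H #> t) <#> K"
    then obtain h k where s: "h \<in> H" "k \<in> K" "s = h \<otimes> t \<otimes> k"
      unfolding double_coset_altdef by blast
    then have "s \<in> carrier G" using assms(1,2) t by auto
    then show "s \<in> ?fibre (f t)" using complete[OF _ t] s by auto
  next
    fix s assume "s \<in> ?fibre (f t)"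
    then show "s \<in> (H #> t) <#> K"
      unfolding double_coset_altdef using complete[OF _ t] by auto
  qed
  have "double_cosets G H K = (\<lambda>t. (H #> t) <#> K) ` carrier G"
    unfolding double_cosets_def by (rule Setcompr_eq_image)
  also have "\<dots> = (\<lambda>t. ?fibre (f t)) ` carrier G"
    using fibre by (rule image_cong[OF refl])
  also have "\<dots> = ?fibre ` f ` carrier G"
    by (simp only: image_image)
  finally have "card (double_cosets G H K) = card (?fibre ` f ` carrier G)" by simp
  moreover have "inj_on ?fibre (f ` carrier G)"
  proof (rule inj_onI)
    fix v w assume "v \<in> f ` carrier G" and vw: "?fibre v = ?fibre w"
    then obtain t where "t \<in> ?fibre v" by blast
    then have "t \<in> ?fibre w" unfolding vw .
    with \<open>t \<in> ?fibre v\<close> show "v = w" by simp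
  qed
  ultimately show ?thesis by (simp add: card_image)
qed

section \<open>Left cosets of L\<close>

abbreviation tuple_sum :: "nat \<Rightarrow> nat \<Rightarrow> (nat \<Rightarrow> int) \<Rightarrow> int"
  where "tuple_sum m n \<theta> \<equiv> (\<Otimes>\<^bsub>integer_mod_group m\<^esub>i\<in>{1..n}. \<theta> i)"

lemma tuple_sum_closed:
  assumes "\<theta> \<in> carrier (tuple_group m n)"
  shows "tuple_sum m n \<theta> \<in> carrier (integer_mod_group m)"
proof -
  interpret C: comm_group "integer_mod_group m" by simp
  show ?thesis using assms by (intro C.finprod_closed) auto
qed

lemma tuple_sum_wreath_mult:
  assumes "(\<theta>, \<tau>) \<in> carrier (wreath m n)" "(\<eta>, \<upsilon>) \<in> carrier (wreath m n)"
  shows "tuple_sum m n (\<theta> \<otimes>\<^bsub>tuple_group m n\<^esub> permute_tuple n \<tau> \<eta>) =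
    tuple_sum m n \<theta> \<otimes>\<^bsub>integer_mod_group m\<^esub> tuple_sum m n \<eta>"
proof -
  have *: "\<theta> \<in> carrier (tuple_group m n)" "\<eta> \<in> carrier (tuple_group m n)" "\<tau> permutes {1..n}"
    using assms by (simp_all add: carrier_wreath sym_group_carrier del: carrier_product_group)
  show ?thesis
    unfolding finprod_tuple_mult[OF *(1) permute_tuple_closed[OF *(3,2)]]
      finprod_permute_tuple[OF *(3,2)] ..
qed

lemma mem_T_group_iff:
  "((\<rho>, \<sigma>), (\<theta>, \<tau>), \<phi>) \<in> carrier T_group \<longleftrightarrow>
    (\<rho>, \<sigma>) \<in> carrier (wreath 2 24) \<and> (\<theta>, \<tau>) \<in> carrier (wreath 3 8) \<and> \<phi> \<in> carrier (sym_group 24)"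
  by (auto simp: T_group_def)

lemma mult_T_group:
  "((\<rho>, \<sigma>), (\<theta>, \<tau>), \<phi>) \<otimes>\<^bsub>T_group\<^esub> ((\<rho>', \<sigma>'), (\<theta>', \<tau>'), \<phi>') =
    ((\<rho> \<otimes>\<^bsub>tuple_group 2 24\<^esub> permute_tuple 24 \<sigma> \<rho>', \<sigma> \<circ> \<sigma>'),
     (\<theta> \<otimes>\<^bsub>tuple_group 3 8\<^esub> permute_tuple 8 \<tau> \<theta>', \<tau> \<circ> \<tau>'), \<phi> \<circ> \<phi>')"
  by (simp add: T_group_def mult_wreath sym_group_mult del: mult_product_group)

lemma mem_L_iff:
  "((\<rho>, \<sigma>), (\<theta>, \<tau>), \<phi>) \<in> L_subgroup \<longleftrightarrow>
    \<rho> = \<one>\<^bsub>tuple_group 2 24\<^esub> \<and> \<sigma> \<in> carrier (sym_group 24) \<and> (\<theta>, \<tau>) \<in> carrier (wreath 3 8) \<and>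
    \<phi> \<in> carrier (sym_group 24) \<and> tuple_sum 3 8 \<theta> = \<one>\<^bsub>integer_mod_group 3\<^esub> \<and> sign \<tau> = sign \<phi>"
  unfolding L_subgroup_def mem_Collect_eq prod.inject by blast

text \<open>Membership \<open>y \<in> x L\<close> means \<open>x\<inverse> y \<in> L\<close>. Writing \<open>y = x l\<close> avoids inverting in the wreath
  products: the first tuple of \<open>y\<close> is that of \<open>x\<close> plus a permuted tuple of \<open>l\<close>, and the sum and
  the signs are multiplicative, so each defining condition on \<open>l\<close> becomes a comparison of \<open>x\<close>
  and \<open>y\<close>.\<close>

lemma mem_L_coset_iff:
  assumes x: "((\<rho>, \<sigma>), (\<theta>, \<tau>), \<phi>) \<in> carrier T_group" (is "?x \<in> _")
    and y: "((\<rho>', \<sigma>'), (\<theta>', \<tau>'), \<phi>') \<in> carrier T_group" (is "?y \<in> _")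
  shows "(\<exists>l\<in>L_subgroup. ?y = ?x \<otimes>\<^bsub>T_group\<^esub> l) \<longleftrightarrow>
    \<rho>' = \<rho> \<and> tuple_sum 3 8 \<theta>' = tuple_sum 3 8 \<theta> \<and> sign \<tau>' * sign \<phi>' = sign \<tau> * sign \<phi>"
proof -
  interpret C: comm_group "integer_mod_group 3" by simp
  interpret A: group "tuple_group 2 24" by (rule group_tuple_group)
  interpret T: group T_group by (rule group_T_group)
  note [simp del] = carrier_product_group mult_product_group one_product_group
    mult_integer_mod_group one_integer_mod_group One_nat_def
  note [simp] = mem_T_group_iff carrier_wreath sym_group_carrier
  note perm = permutes_imp_permutation[OF finite_atLeastAtMost]
  define l where "l = inv\<^bsub>T_group\<^esub> ?x \<otimes>\<^bsub>T_group\<^esub> ?y"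
  have l_carrier: "l \<in> carrier T_group" and xl: "?y = ?x \<otimes>\<^bsub>T_group\<^esub> l"
    using x y by (simp_all only: l_def T.m_closed T.inv_closed T.m_assoc[symmetric] T.r_inv T.l_one)
  obtain \<rho>l \<sigma>l \<theta>l \<tau>l \<phi>l where l: "l = ((\<rho>l, \<sigma>l), (\<theta>l, \<tau>l), \<phi>l)" by (metis surj_pair)
  have L_subset: "L_subgroup \<subseteq> carrier T_group" using subgroup.subset[OF subgroup_L] .
  have "(\<exists>l\<in>L_subgroup. ?y = ?x \<otimes>\<^bsub>T_group\<^esub> l) \<longleftrightarrow> l \<in> L_subgroup"
  proof
    assume "\<exists>l\<in>L_subgroup. ?y = ?x \<otimes>\<^bsub>T_group\<^esub> l"
    then obtain l' where l': "l' \<in> L_subgroup" "?x \<otimes>\<^bsub>T_group\<^esub> l' = ?x \<otimes>\<^bsub>T_group\<^esub> l"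
      using xl by auto
    then have "l' = l"
      using T.l_cancel[OF l'(2) _ l_carrier x] L_subset by blast
    then show "l \<in> L_subgroup" using l'(1) by blast
  next
    assume "l \<in> L_subgroup"
    with xl show "\<exists>l\<in>L_subgroup. ?y = ?x \<otimes>\<^bsub>T_group\<^esub> l" by blast
  qed
  also have "\<dots> \<longleftrightarrow> \<rho>l = \<one>\<^bsub>tuple_group 2 24\<^esub> \<and>
      tuple_sum 3 8 \<theta>l = \<one>\<^bsub>integer_mod_group 3\<^esub> \<and> sign \<tau>l = sign \<phi>l"
    using l_carrier by (auto simp: l mem_L_iff)
  also have "\<rho>l = \<one>\<^bsub>tuple_group 2 24\<^esub> \<longleftrightarrow> \<rho>' = \<rho>"
  proof -
    have c: "\<sigma> permutes {1..24}" "\<rho> \<in> carrier (tuple_group 2 24)" "\<rho>l \<in> carrier (tuple_group 2 24)"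
      using x l_carrier by (simp_all add: l)
    have \<rho>': "\<rho>' = \<rho> \<otimes>\<^bsub>tuple_group 2 24\<^esub> permute_tuple 24 \<sigma> \<rho>l"
      using xl by (simp add: l mult_T_group)
    have pl: "permute_tuple 24 (inv' \<sigma>) (permute_tuple 24 \<sigma> \<rho>l) = \<rho>l"
      using c permute_tuple_comp[OF permutes_inv[OF c(1)] c(1), of \<rho>l]
      by (simp add: permutes_inv_o permute_tuple_id)
    have "\<rho>' = \<rho> \<longleftrightarrow> permute_tuple 24 \<sigma> \<rho>l = \<one>\<^bsub>tuple_group 2 24\<^esub>"
      unfolding \<rho>' using c by (simp add: permute_tuple_closed)
    then show ?thesis
      using pl permute_tuple_one[OF permutes_inv[OF c(1)]] permute_tuple_one[OF c(1)] by metis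
  qed
  also have "tuple_sum 3 8 \<theta>l = \<one>\<^bsub>integer_mod_group 3\<^esub> \<longleftrightarrow> tuple_sum 3 8 \<theta>' = tuple_sum 3 8 \<theta>"
  proof -
    have c: "(\<theta>, \<tau>) \<in> carrier (wreath 3 8)" "(\<theta>l, \<tau>l) \<in> carrier (wreath 3 8)"
      using x l_carrier by (simp_all add: l)
    then have "tuple_sum 3 8 \<theta> \<in> carrier (integer_mod_group 3)"
      "tuple_sum 3 8 \<theta>l \<in> carrier (integer_mod_group 3)"
      by (simp_all add: tuple_sum_closed)
    moreover have "tuple_sum 3 8 \<theta>' = tuple_sum 3 8 \<theta> \<otimes>\<^bsub>integer_mod_group 3\<^esub> tuple_sum 3 8 \<theta>l"
      using tuple_sum_wreath_mult[OF c] xl by (simp add: l mult_T_group)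
    ultimately show ?thesis by simp
  qed
  also have "sign \<tau>l = sign \<phi>l \<longleftrightarrow> sign \<tau>' * sign \<phi>' = sign \<tau> * sign \<phi>"
  proof -
    have "\<tau>' = \<tau> \<circ> \<tau>l" "\<phi>' = \<phi> \<circ> \<phi>l" using xl by (simp_all add: l mult_T_group)
    moreover have "\<tau> permutes {1..8}" "\<tau>l permutes {1..8}" "\<phi> permutes {1..24}" "\<phi>l permutes {1..24}"
      using x l_carrier by (simp_all add: l)
    ultimately have "sign \<tau>' = sign \<tau> * sign \<tau>l" "sign \<phi>' = sign \<phi> * sign \<phi>l"
      by (simp_all add: sign_compose perm)
    then show ?thesis
      by (cases \<tau> rule: sign_cases; cases \<tau>l rule: sign_cases;
          cases \<phi> rule: sign_cases; cases \<phi>l rule: sign_cases) simp_all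
  qed
  finally show ?thesis .
qed

section \<open>The action of I\<close>

lemma tuple_group_2_entries:
  assumes "\<rho> \<in> carrier (tuple_group 2 n)" "i \<in> {1..n}"
  shows "\<rho> i = 0 \<or> \<rho> i = 1"
proof -
  have "\<rho> i \<in> {0..<2}"
    using assms by (auto simp: carrier_integer_mod_group PiE_iff)
  then show ?thesis by auto
qed

lemma wreath_mult_entry:
  "i \<in> {1..n} \<Longrightarrow>
    (\<alpha> \<otimes>\<^bsub>tuple_group m n\<^esub> permute_tuple n \<beta> \<rho>) i = (\<alpha> i + \<rho> (inv' \<beta> i)) mod int m"
  by (simp add: permute_tuple_def)

text \<open>Either nothing happens to the pair \<open>(x, y)\<close> of entries at \<open>a\<close> and \<open>b\<close>, or it becomes
  \<open>(1 - y, 1 - x)\<close>, and \<open>(1 - y) - (1 - x) = x - y\<close>.\<close>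

lemma flip_preserves_difference:
  assumes \<beta>: "\<beta> permutes {1..n}" "\<beta> ` {a, b} = {a, b}" and \<rho>: "\<rho> \<in> carrier (tuple_group 2 n)"
    and ab: "a \<in> {1..n}" "b \<in> {1..n}" "a \<noteq> b"
    and keep: "\<forall>i\<in>{a, b}. \<beta> i = i \<Longrightarrow> \<alpha> a = 0 \<and> \<alpha> b = 0"
    and flip: "\<not> (\<forall>i\<in>{a, b}. \<beta> i = i) \<Longrightarrow> \<alpha> a = 1 \<and> \<alpha> b = 1"
    and \<rho>': "\<rho>' = \<alpha> \<otimes>\<^bsub>tuple_group 2 n\<^esub> permute_tuple n \<beta> \<rho>"
  shows "\<rho>' a - \<rho>' b = \<rho> a - \<rho> b"
proof -
  have e: "\<rho>' i = (\<alpha> i + \<rho> (inv' \<beta> i)) mod 2" if "i \<in> {1..n}" for i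
    unfolding \<rho>' using wreath_mult_entry[OF that, where \<alpha> = \<alpha> and m = 2] by simp
  note v = tuple_group_2_entries[OF \<rho> ab(1)] tuple_group_2_entries[OF \<rho> ab(2)]
  note i = permutes_inv_eq[OF \<beta>(1)]
  consider "\<beta> a = a" "\<beta> b = b" | "\<beta> a = b" "\<beta> b = a"
    using \<beta>(2) by (auto simp: doubleton_eq_iff)
  then show ?thesis
  proof cases
    case 1
    then have "inv' \<beta> a = a" "inv' \<beta> b = b" "\<alpha> a = 0" "\<alpha> b = 0" using keep by (auto simp: i)
    then show ?thesis using v by (auto simp: e[OF ab(1)] e[OF ab(2)])
  next
    case 2
    then have "inv' \<beta> a = b" "inv' \<beta> b = a" "\<alpha> a = 1" "\<alpha> b = 1" using flip ab(3) by (auto simp: i)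
    then show ?thesis using v by (auto simp: e[OF ab(1)] e[OF ab(2)])
  qed
qed

definition flip_pairs :: "nat set \<Rightarrow> nat \<Rightarrow> nat"
  where "flip_pairs S i = (if (i + 1) div 2 \<in> S then if odd i then i + 1 else i - 1 else i)"

lemma flip_pairs_pair:
  assumes "k \<ge> 1"
  shows "flip_pairs S (2*k-1) = (if k \<in> S then 2*k else 2*k-1)"
    and "flip_pairs S (2*k) = (if k \<in> S then 2*k-1 else 2*k)"
  using assms by (auto simp: flip_pairs_def)

lemma pair_cases:
  fixes i n :: nat
  assumes "i \<in> {1..2*n}"
  obtains k where "k \<in> {1..n}" "i = 2*k-1" | k where "k \<in> {1..n}" "i = 2*k"
proof (cases "odd i")
  case True
  then obtain j where "i = 2*j+1" by (auto elim: oddE)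
  then show ?thesis using assms that(1)[of "j+1"] by auto
next
  case False
  then obtain j where "i = 2*j" by (auto elim: evenE)
  then show ?thesis using assms that(2)[of j] by auto
qed

lemma flip_pairs_involution:
  assumes "S \<subseteq> {1..n}"
  shows "flip_pairs S (flip_pairs S i) = i"
proof (cases "(i + 1) div 2 \<in> S")
  case True
  then have "i \<in> {1..2*n}" using assms by (cases i) auto
  then show ?thesis by (cases rule: pair_cases) (auto simp: flip_pairs_pair simp del: One_nat_def)
qed (simp add: flip_pairs_def)

lemma flip_pairs_permutes:
  assumes "S \<subseteq> {1..n}"
  shows "flip_pairs S permutes {1..2*n}"
proof -
  have "flip_pairs S i = i" if "i \<notin> {1..2*n}" for i
    using that assms by (cases i) (auto simp: flip_pairs_def)
  moreover have "\<exists>!i. flip_pairs S i = j" for j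
    using flip_pairs_involution[OF assms] by metis
  ultimately show ?thesis by (simp add: permutes_def)
qed

lemma inv_flip_pairs:
  assumes "S \<subseteq> {1..n}"
  shows "inv' (flip_pairs S) = flip_pairs S"
  using flip_pairs_involution[OF assms] by (intro inv_unique_comp) auto

text \<open>If the two tuples differ at \<open>2*k-1\<close> while the differences over the \<open>k\<close>-th pair agree, then the
  pair is \<open>(0, 0)\<close> in one and \<open>(1, 1)\<close> in the other; exactly these pairs have to be flipped.\<close>

lemma equal_differences_obtain_flip:
  fixes n :: nat
  assumes \<rho>: "\<rho> \<in> carrier (tuple_group 2 (2*n))" and \<rho>': "\<rho>' \<in> carrier (tuple_group 2 (2*n))"
    and diff: "\<And>k. k \<in> {1..n} \<Longrightarrow> \<rho>' (2*k-1) - \<rho>' (2*k) = \<rho> (2*k-1) - \<rho> (2*k)"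
  obtains \<alpha> \<beta> where "(\<alpha>, \<beta>) \<in> carrier (wreath 2 (2*n))"
    "\<rho>' = \<alpha> \<otimes>\<^bsub>tuple_group 2 (2*n)\<^esub> permute_tuple (2*n) \<beta> \<rho>"
    "\<forall>k\<in>{1..n}. \<beta> ` {2*k-1, 2*k} = {2*k-1, 2*k}"
    "\<forall>k\<in>{1..n}.
      ((\<forall>i\<in>{2*k-1, 2*k}. \<beta> i = i) \<longrightarrow> \<alpha> (2*k-1) = 0 \<and> \<alpha> (2*k) = 0) \<and>
      (\<not> (\<forall>i\<in>{2*k-1, 2*k}. \<beta> i = i) \<longrightarrow> \<alpha> (2*k-1) = 1 \<and> \<alpha> (2*k) = 1)"
proof -
  define S where "S = {k \<in> {1..n}. \<rho> (2*k-1) \<noteq> \<rho>' (2*k-1)}"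
  have S: "S \<subseteq> {1..n}" by (auto simp: S_def)
  define \<alpha> :: "nat \<Rightarrow> int" where "\<alpha> = (\<lambda>i\<in>{1..2*n}. if (i + 1) div 2 \<in> S then 1 else 0)"
  have \<alpha>: "\<alpha> (2*k-1) = (if k \<in> S then 1 else 0)" "\<alpha> (2*k) = (if k \<in> S then 1 else 0)"
    if "k \<in> {1..n}" for k
  proof -
    have "2*k-1 \<in> {1..2*n}" "2*k \<in> {1..2*n}" "(2*k-1+1) div 2 = k" "(2*k+1) div 2 = k"
      using that by auto
    then show "\<alpha> (2*k-1) = (if k \<in> S then 1 else 0)" "\<alpha> (2*k) = (if k \<in> S then 1 else 0)"
      by (simp_all only: \<alpha>_def restrict_apply' )
  qed
  have \<alpha>_carrier: "\<alpha> \<in> carrier (tuple_group 2 (2*n))"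
    by (auto simp: \<alpha>_def carrier_integer_mod_group)
  let ?\<beta> = "flip_pairs S"
  have "\<rho>' i = (\<alpha> \<otimes>\<^bsub>tuple_group 2 (2*n)\<^esub> permute_tuple (2*n) ?\<beta> \<rho>) i" for i
  proof (cases "i \<in> {1..2*n}")
    case True
    have "\<rho>' i = (\<alpha> i + \<rho> (?\<beta> i)) mod 2"
      if k: "k \<in> {1..n}" and i: "i = 2*k-1 \<or> i = 2*k" for k
    proof -
      have "2*k-1 \<in> {1..2*n}" "2*k \<in> {1..2*n}" using k by auto
      note v = tuple_group_2_entries[OF \<rho> this(1)] tuple_group_2_entries[OF \<rho> this(2)]
        tuple_group_2_entries[OF \<rho>' this(1)] tuple_group_2_entries[OF \<rho>' this(2)]
      have \<beta>: "?\<beta> (2*k-1) = (if k \<in> S then 2*k else 2*k-1)"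
        "?\<beta> (2*k) = (if k \<in> S then 2*k-1 else 2*k)"
        using k flip_pairs_pair[of k S] by auto
      have m: "k \<in> S \<longleftrightarrow> \<rho> (2*k-1) \<noteq> \<rho>' (2*k-1)" using k by (simp add: S_def)
      show ?thesis
        using i v diff[OF k] m \<alpha>[OF k] \<beta>
        by (elim disjE) (simp_all del: One_nat_def)
    qed
    then have "\<rho>' i = (\<alpha> i + \<rho> (?\<beta> i)) mod 2"
      using True by (elim pair_cases) auto
    then show ?thesis
      using wreath_mult_entry[OF True, where \<alpha> = \<alpha> and m = 2 and \<beta> = ?\<beta> and \<rho> = \<rho>] by (simp add: inv_flip_pairs[OF S])
  next
    case False
    then have "\<rho>' i = undefined" using \<rho>' by auto
    then show ?thesis using False by (simp only: mult_product_group restrict_apply if_False)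
  qed
  then have eq: "\<rho>' = \<alpha> \<otimes>\<^bsub>tuple_group 2 (2*n)\<^esub> permute_tuple (2*n) ?\<beta> \<rho>" by (rule ext)
  show thesis
  proof (rule that[OF _ eq])
    show "(\<alpha>, ?\<beta>) \<in> carrier (wreath 2 (2*n))"
      using \<alpha>_carrier flip_pairs_permutes[OF S]
      by (simp add: carrier_wreath sym_group_carrier del: carrier_product_group)
    have \<beta>: "?\<beta> (2*k-1) = (if k \<in> S then 2*k else 2*k-1)"
        "?\<beta> (2*k) = (if k \<in> S then 2*k-1 else 2*k)" if "k \<in> {1..n}" for k
      using that flip_pairs_pair[of k S] by auto
    show "\<forall>k\<in>{1..n}. ?\<beta> ` {2*k-1, 2*k} = {2*k-1, 2*k}"
    proof
      fix k assume k: "k \<in> {1..n}"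
      show "?\<beta> ` {2*k-1, 2*k} = {2*k-1, 2*k}"
        unfolding image_insert image_empty \<beta>[OF k] by auto
    qed
    have "(\<forall>i\<in>{2*k-1, 2*k}. ?\<beta> i = i) \<longleftrightarrow> k \<notin> S" if k: "k \<in> {1..n}" for k
    proof -
      have "2*k-1 \<noteq> 2*k" using k by auto
      then show ?thesis unfolding ball_simps \<beta>[OF k] by auto
    qed
    then show "\<forall>k\<in>{1..n}.
        ((\<forall>i\<in>{2*k-1, 2*k}. ?\<beta> i = i) \<longrightarrow> \<alpha> (2*k-1) = 0 \<and> \<alpha> (2*k) = 0) \<and>
        (\<not> (\<forall>i\<in>{2*k-1, 2*k}. ?\<beta> i = i) \<longrightarrow> \<alpha> (2*k-1) = 1 \<and> \<alpha> (2*k) = 1)"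
      using \<alpha> by (simp del: One_nat_def)
  qed
qed

lemma obtain_block_permutation_with_sign:
  assumes "e = 1 \<or> e = - 1"
  obtains \<gamma> where "\<gamma> \<in> carrier (sym_group 24)" "sign \<gamma> = e"
    "\<forall>k\<in>{1..6}. \<gamma> ` {4*k-3, 4*k-2, 4*k-1, 4*k} = {4*k-3, 4*k-2, 4*k-1, 4*k}"
  using assms
proof (rule disjE)
  assume e: "e = 1"
  show thesis by (rule that[of id]) (auto simp: e sym_group_carrier permutes_id)
next
  assume e: "e = - 1"
  have "transpose (1::nat) 2 permutes {1..24}" by (rule permutes_swap_id) auto
  moreover have "sign (transpose (1::nat) 2) = - 1" by (simp add: sign_swap_id)
  moreover have "transpose 1 2 ` {4*k-3, 4*k-2, 4*k-1, 4*k} = {4*k-3, 4*k-2, 4*k-1, 4*k}"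
    if "k \<in> {1..6::nat}" for k
  proof (cases "k = 1")
    case False
    then have "2 < 4*k-3" "2 < 4*k-2" "2 < 4*k-1" "2 < 4*k" using that by auto
    then show ?thesis by (intro transpose_image_eq) (simp del: One_nat_def)
  qed auto
  ultimately show thesis by (intro that[of "transpose 1 2"]) (auto simp: e sym_group_carrier)
qed

section \<open>The complete invariant\<close>

definition puzzle_invariant :: "puzzle \<Rightarrow> (nat \<Rightarrow> int) \<times> int"
  where "puzzle_invariant = (\<lambda>((\<rho>, \<sigma>), (\<theta>, \<tau>), \<phi>).
    (\<lambda>k\<in>{1..12}. \<rho> (2*k-1) - \<rho> (2*k), tuple_sum 3 8 \<theta>))"

text \<open>Left multiplication by an element of \<open>I\<close> with components \<open>\<alpha>\<close>, \<open>\<beta>\<close>, \<open>\<gamma>\<close> turns \<open>\<rho>\<close> into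
  \<open>\<alpha> + \<beta> \<cdot> \<rho>\<close>, keeps the sum and multiplies the sign by \<open>sign \<gamma>\<close>. As \<open>\<gamma>\<close> can be chosen
  independently of \<open>(\<alpha>, \<beta>)\<close>, equality of double cosets reduces to equality of the sums and to
  the existence of a flip carrying \<open>\<rho>\<close> to \<open>\<rho>'\<close>.\<close>

lemma puzzle_invariant_eq_iff:
  assumes s: "s \<in> carrier T_group" and t: "t \<in> carrier T_group"
  shows "puzzle_invariant s = puzzle_invariant t \<longleftrightarrow>
    (\<exists>h\<in>I_subgroup. \<exists>l\<in>L_subgroup. s = h \<otimes>\<^bsub>T_group\<^esub> t \<otimes>\<^bsub>T_group\<^esub> l)"
proof -
  interpret T: group T_group by (rule group_T_group)
  interpret B: group "tuple_group 3 8" by (rule group_tuple_group)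
  note [simp del] = carrier_product_group mult_product_group one_product_group One_nat_def
    mult_integer_mod_group one_integer_mod_group
  note [simp] = carrier_wreath sym_group_carrier
  note perm = permutes_imp_permutation[OF finite_atLeastAtMost]
  obtain \<rho>' \<sigma>' \<theta>' \<tau>' \<phi>' where s_eq: "s = ((\<rho>', \<sigma>'), (\<theta>', \<tau>'), \<phi>')" by (metis surj_pair)
  obtain \<rho> \<sigma> \<theta> \<tau> \<phi> where t_eq: "t = ((\<rho>, \<sigma>), (\<theta>, \<tau>), \<phi>)" by (metis surj_pair)
  note s' = s[unfolded s_eq] and t' = t[unfolded t_eq]
  have c: "\<rho> \<in> carrier (tuple_group 2 24)" "\<rho>' \<in> carrier (tuple_group 2 24)"
    "\<theta> \<in> carrier (tuple_group 3 8)" "\<phi> permutes {1..24}"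
    using s' t' by (simp_all add: mem_T_group_iff)
  have coset: "(\<exists>l\<in>L_subgroup. s = ((\<alpha>, \<beta>), (\<one>\<^bsub>tuple_group 3 8\<^esub>, id), \<gamma>) \<otimes>\<^bsub>T_group\<^esub> t \<otimes>\<^bsub>T_group\<^esub> l) \<longleftrightarrow>
      \<rho>' = \<alpha> \<otimes>\<^bsub>tuple_group 2 24\<^esub> permute_tuple 24 \<beta> \<rho> \<and> tuple_sum 3 8 \<theta>' = tuple_sum 3 8 \<theta> \<and>
      sign \<tau>' * sign \<phi>' = sign \<tau> * (sign \<gamma> * sign \<phi>)"
    if h: "((\<alpha>, \<beta>), (\<one>\<^bsub>tuple_group 3 8\<^esub>, id), \<gamma>) \<in> I_subgroup" for \<alpha> \<beta> \<gamma>
  proof -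
    have hc: "((\<alpha>, \<beta>), (\<one>\<^bsub>tuple_group 3 8\<^esub>, id), \<gamma>) \<in> carrier T_group"
      using subgroup.subset[OF subgroup_I] h by blast
    have ht: "((\<alpha>, \<beta>), (\<one>\<^bsub>tuple_group 3 8\<^esub>, id), \<gamma>) \<otimes>\<^bsub>T_group\<^esub> t =
        ((\<alpha> \<otimes>\<^bsub>tuple_group 2 24\<^esub> permute_tuple 24 \<beta> \<rho>, \<beta> \<circ> \<sigma>), (\<theta>, \<tau>), \<gamma> \<circ> \<phi>)"
      using c by (simp add: t_eq mult_T_group permute_tuple_id)
    have "\<gamma> permutes {1..24}" using hc by (simp add: mem_T_group_iff)
    then have "sign (\<gamma> \<circ> \<phi>) = sign \<gamma> * sign \<phi>"
      using c(4) by (simp add: sign_compose perm)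
    moreover have "((\<alpha> \<otimes>\<^bsub>tuple_group 2 24\<^esub> permute_tuple 24 \<beta> \<rho>, \<beta> \<circ> \<sigma>), (\<theta>, \<tau>), \<gamma> \<circ> \<phi>) \<in> carrier T_group"
      using T.m_closed[OF hc t] unfolding ht .
    ultimately show ?thesis
      unfolding ht s_eq using mem_L_coset_iff[OF _ s'] by simp
  qed
  have inv: "puzzle_invariant s = puzzle_invariant t \<longleftrightarrow>
      (\<forall>k\<in>{1..12}. \<rho>' (2*k-1) - \<rho>' (2*k) = \<rho> (2*k-1) - \<rho> (2*k)) \<and>
      tuple_sum 3 8 \<theta>' = tuple_sum 3 8 \<theta>"
    unfolding puzzle_invariant_def s_eq t_eq prod.case prod.inject
    by (auto simp: fun_eq_iff restrict_def)
  show ?thesis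
  proof
    assume "\<exists>h\<in>I_subgroup. \<exists>l\<in>L_subgroup. s = h \<otimes>\<^bsub>T_group\<^esub> t \<otimes>\<^bsub>T_group\<^esub> l"
    then obtain \<alpha> \<beta> \<gamma> where h: "((\<alpha>, \<beta>), (\<one>\<^bsub>tuple_group 3 8\<^esub>, id), \<gamma>) \<in> I_subgroup"
      and l: "\<exists>l\<in>L_subgroup. s = ((\<alpha>, \<beta>), (\<one>\<^bsub>tuple_group 3 8\<^esub>, id), \<gamma>) \<otimes>\<^bsub>T_group\<^esub> t \<otimes>\<^bsub>T_group\<^esub> l"
      unfolding I_subgroup_def by blast
    note l' = l[unfolded coset[OF h]] and h' = h[unfolded I_subgroup_iff]
    have "\<rho>' (2*k-1) - \<rho>' (2*k) = \<rho> (2*k-1) - \<rho> (2*k)" if k: "k \<in> {1..12}" for k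
    proof (rule flip_preserves_difference[OF _ _ c(1)])
      show "\<beta> permutes {1..24}" using h' by simp
      show "\<beta> ` {2*k-1, 2*k} = {2*k-1, 2*k}" using h' k by blast
      show "2*k-1 \<in> {1..24}" "2*k \<in> {1..24}" "2*k-1 \<noteq> 2*k" using k by auto
      show "\<alpha> (2*k-1) = 0 \<and> \<alpha> (2*k) = 0" if "\<forall>i\<in>{2*k-1, 2*k}. \<beta> i = i"
        using h' k that by blast
      show "\<alpha> (2*k-1) = 1 \<and> \<alpha> (2*k) = 1" if "\<not> (\<forall>i\<in>{2*k-1, 2*k}. \<beta> i = i)"
        using h' k that by blast
      show "\<rho>' = \<alpha> \<otimes>\<^bsub>tuple_group 2 24\<^esub> permute_tuple 24 \<beta> \<rho>" using l' by blast
    qed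
    then show "puzzle_invariant s = puzzle_invariant t" using inv l' by blast
  next
    assume "puzzle_invariant s = puzzle_invariant t"
    then have diff: "\<And>k. k \<in> {1..12} \<Longrightarrow> \<rho>' (2*k-1) - \<rho>' (2*k) = \<rho> (2*k-1) - \<rho> (2*k)"
      and sum: "tuple_sum 3 8 \<theta>' = tuple_sum 3 8 \<theta>"
      using inv by blast+
    have 24: "2 * 12 = (24::nat)" by simp
    obtain \<alpha> \<beta> where \<alpha>\<beta>: "(\<alpha>, \<beta>) \<in> carrier (wreath 2 24)"
      "\<rho>' = \<alpha> \<otimes>\<^bsub>tuple_group 2 24\<^esub> permute_tuple 24 \<beta> \<rho>"
      "\<forall>k\<in>{1..12}. \<beta> ` {2*k-1, 2*k} = {2*k-1, 2*k}"
      "\<forall>k\<in>{1..12}.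
        ((\<forall>i\<in>{2*k-1, 2*k}. \<beta> i = i) \<longrightarrow> \<alpha> (2*k-1) = 0 \<and> \<alpha> (2*k) = 0) \<and>
        (\<not> (\<forall>i\<in>{2*k-1, 2*k}. \<beta> i = i) \<longrightarrow> \<alpha> (2*k-1) = 1 \<and> \<alpha> (2*k) = 1)"
      by (rule equal_differences_obtain_flip[where n = 12, unfolded 24, OF c(1,2) diff])
    \<comment> \<open>The sign by which \<open>s\<close> and \<open>t\<close> still differ; signs are their own inverses.\<close>
    define e where "e = sign \<tau>' * sign \<phi>' * sign \<tau> * sign \<phi>"
    have e: "e = 1 \<or> e = - 1" and e': "sign \<tau>' * sign \<phi>' = sign \<tau> * (e * sign \<phi>)"
      unfolding e_def
      by (cases \<tau> rule: sign_cases; cases \<tau>' rule: sign_cases;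
          cases \<phi> rule: sign_cases; cases \<phi>' rule: sign_cases; simp)+
    obtain \<gamma> where \<gamma>: "\<gamma> \<in> carrier (sym_group 24)" "sign \<gamma> = e"
      "\<forall>k\<in>{1..6}. \<gamma> ` {4*k-3, 4*k-2, 4*k-1, 4*k} = {4*k-3, 4*k-2, 4*k-1, 4*k}"
      by (rule obtain_block_permutation_with_sign[OF e])
    have h: "((\<alpha>, \<beta>), (\<one>\<^bsub>tuple_group 3 8\<^esub>, id), \<gamma>) \<in> I_subgroup"
      unfolding I_subgroup_iff using \<alpha>\<beta> \<gamma> by blast
    have "\<exists>l\<in>L_subgroup. s = ((\<alpha>, \<beta>), (\<one>\<^bsub>tuple_group 3 8\<^esub>, id), \<gamma>) \<otimes>\<^bsub>T_group\<^esub> t \<otimes>\<^bsub>T_group\<^esub> l"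
      unfolding coset[OF h] using \<alpha>\<beta>(2) sum e' \<gamma>(2) by simp
    then show "\<exists>h\<in>I_subgroup. \<exists>l\<in>L_subgroup. s = h \<otimes>\<^bsub>T_group\<^esub> t \<otimes>\<^bsub>T_group\<^esub> l"
      using h by blast
  qed
qed

lemma puzzle_invariant_range:
  "puzzle_invariant ` carrier T_group = ({1..12} \<rightarrow>\<^sub>E {-1, 0, 1}) \<times> {0, 1, 2}"
proof (intro equalityI subsetI)
  fix w assume "w \<in> puzzle_invariant ` carrier T_group"
  then obtain \<rho> \<sigma> \<theta> \<tau> \<phi> where t: "((\<rho>, \<sigma>), (\<theta>, \<tau>), \<phi>) \<in> carrier T_group"
    and w: "w = puzzle_invariant ((\<rho>, \<sigma>), (\<theta>, \<tau>), \<phi>)"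
    by (metis (no_types, opaque_lifting) imageE surj_pair)
  have c: "\<rho> \<in> carrier (tuple_group 2 24)" "\<theta> \<in> carrier (tuple_group 3 8)"
    using t by (simp_all add: mem_T_group_iff carrier_wreath del: carrier_product_group)
  have "\<rho> (2*k-1) - \<rho> (2*k) \<in> {-1, 0, 1}" if k: "k \<in> {1..12}" for k
  proof -
    have "2*k-1 \<in> {1..24}" "2*k \<in> {1..24}" using k by auto
    then show ?thesis using tuple_group_2_entries[OF c(1), of "2*k-1"] tuple_group_2_entries[OF c(1), of "2*k"]
      by auto
  qed
  then have "(\<lambda>k\<in>{1..12}. \<rho> (2*k-1) - \<rho> (2*k)) \<in> {1..12} \<rightarrow>\<^sub>E {-1, 0, 1}"
    unfolding restrict_PiE_iff by (rule ballI)
  moreover have "tuple_sum 3 8 \<theta> \<in> {0, 1, 2}"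
    using tuple_sum_closed[OF c(2)] by (auto simp: carrier_integer_mod_group)
  ultimately show "w \<in> ({1..12} \<rightarrow>\<^sub>E {-1, 0, 1}) \<times> {0, 1, 2}"
    unfolding w puzzle_invariant_def prod.case by (rule SigmaI)
next
  fix w :: "(nat \<Rightarrow> int) \<times> int" assume w: "w \<in> ({1..12} \<rightarrow>\<^sub>E {-1, 0, 1}) \<times> {0, 1, 2}"
  obtain d c where w_eq: "w = (d, c)" by fastforce
  have d: "d \<in> {1..12} \<rightarrow>\<^sub>E {-1, 0, 1}" and c: "c \<in> {0, 1, 2}" using w by (auto simp: w_eq)
  \<comment> \<open>The pair with difference \<open>d k\<close> is \<open>(1, 0)\<close>, \<open>(0, 0)\<close> or \<open>(0, 1)\<close>.\<close>
  define \<rho> :: "nat \<Rightarrow> int" where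
    "\<rho> = (\<lambda>i\<in>{1..24}. if d ((i + 1) div 2) = (if odd i then 1 else - 1) then 1 else 0)"
  \<comment> \<open>A tuple with sum \<open>c\<close>.\<close>
  define \<theta> :: "nat \<Rightarrow> int" where "\<theta> = (\<lambda>i\<in>{1..8}. if i = 1 then c else 0)"
  have \<rho>: "\<rho> \<in> carrier (tuple_group 2 24)"
    by (auto simp: \<rho>_def carrier_integer_mod_group)
  have \<theta>: "\<theta> \<in> carrier (tuple_group 3 8)"
    using c by (auto simp: \<theta>_def carrier_integer_mod_group)
  have t: "((\<rho>, id), (\<theta>, id), id) \<in> carrier T_group"
    using \<rho> \<theta> by (simp add: mem_T_group_iff carrier_wreath sym_group_carrier permutes_id
        del: carrier_product_group)
  have "tuple_sum 3 8 \<theta> = c"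
  proof -
    interpret C: comm_group "integer_mod_group 3" by simp
    have c': "c \<in> carrier (integer_mod_group 3)" using c by (auto simp: carrier_integer_mod_group)
    have "tuple_sum 3 8 \<theta> = (\<Otimes>\<^bsub>integer_mod_group 3\<^esub>i\<in>{1..8::nat}.
        if 1 = i then c else \<one>\<^bsub>integer_mod_group 3\<^esub>)"
      using c' by (intro C.finprod_cong') (auto simp: \<theta>_def carrier_integer_mod_group)
    also have "\<dots> = c"
      using c' by (intro C.finprod_singleton[where f = "\<lambda>_. c"]) auto
    finally show ?thesis .
  qed
  moreover have "(\<lambda>k\<in>{1..12}. \<rho> (2*k-1) - \<rho> (2*k)) = d"
  proof (rule extensionalityI[where A = "{1..12}"])
    show "d \<in> extensional {1..12}" using d by (simp add: PiE_def)
    fix k :: nat assume k: "k \<in> {1..12}"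
    have "2*k-1 \<in> {1..24}" "2*k \<in> {1..24}" "(2*k-1+1) div 2 = k" "(2*k+1) div 2 = k" "odd (2*k-1)"
      using k by auto
    then have "\<rho> (2*k-1) = (if d k = 1 then 1 else 0)" "\<rho> (2*k) = (if d k = - 1 then 1 else 0)"
      by (simp_all add: \<rho>_def del: One_nat_def)
    moreover have "d k \<in> {-1, 0, 1}" using d k by (rule PiE_mem)
    ultimately show "(\<lambda>k\<in>{1..12}. \<rho> (2*k-1) - \<rho> (2*k)) k = d k"
      using k by auto
  qed simp
  ultimately have "w = puzzle_invariant ((\<rho>, id), (\<theta>, id), id)"
    by (simp add: w_eq puzzle_invariant_def)
  then show "w \<in> puzzle_invariant ` carrier T_group" using t by blast
qed

theorem mainTheorem1:
  shows "card (double_cosets T_group I_subgroup L_subgroup) = 3 ^ 13"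
proof -
  interpret T: group T_group by (rule group_T_group)
  have "card (double_cosets T_group I_subgroup L_subgroup) = card (puzzle_invariant ` carrier T_group)"
    using subgroup.subset[OF subgroup_I] subgroup.subset[OF subgroup_L] puzzle_invariant_eq_iff
    by (rule T.card_double_cosets_eq_card_invariants)
  also have "\<dots> = 3 ^ 13"
  proof -
    have "card {-1, 0, 1 :: int} = 3" "card {0, 1, 2 :: int} = 3" by simp_all
    then show ?thesis
      by (simp only: puzzle_invariant_range card_cartesian_product card_PiE finite_atLeastAtMost
          prod_constant card_atLeastAtMost) simp
  qed
  finally show ?thesis .
qed

end
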